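(* Let $F:[0,T)\times M\to\mathbb{R}^{n+1}$ be a smooth solution of the normal hyperbolic mean curvature flow (HMCF'). For any $x\in M$ and any $0\le t_1\le t_2<T$ one has $$\left|\int_{t_1}^{t_2}H(x,t)\,dt\right|=|\gamma(t_2)-\gamma(t_1)|\le\frac{2\pi}{\sqrt n},$$ where $\gamma(t):=\frac{2}{\sqrt n}\arctan\left(\frac{\sigma(t,x)}{\sqrt n}\right)$. In particular, if $T=\infty$, then for any $\epsilon>0$ and any $x\in M$ there exists a sequence $t_k\to\infty$ such that $$|H(x,t_k)|<\epsilon,\qquad k\in\mathbb{N}.$$
   Context: $M$ is an orientable smooth $n$-dimensional manifold and $F$ is a smooth family of immersions. $\frac{d}{dt}$ is the time derivative at a fixed point of $M$; $F_i=\partial F/\partial x^i$; $g_{ij}=\langle F_i,F_j\rangle$ is the induced metric with Levi-Civita connection $\nabla$; $\nu$ is the unit normal (inward pointing when $M$ is compact without boundary); $h_{ij}=-\langle F_i,\nabla_j\nu\rangle$; $H=g^{ij}h_{ij}$ is the mean curvature, $H(x,t)$ its value at $x\in M$ and time $t$; $\sigma=\langle\frac{dF}{dt},\nu\rangle$; $e=\frac12\left(\left|\frac{dF}{dt}\right|^2+n\right)$; $\nabla e=\nabla^ie\,F_i$. The equation (HMCF') is $$\frac{d^2}{dt^2}F=e\,H\nu-\nabla e,\qquad \left(\frac{dF}{dt}\right)^{\top}\Big|_{t=0}=0,$$ where $\top$ denotes the tangential part. *)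

theory Defs
  imports "HOL-Analysis.Analysis"
begin

text \<open>Differentiability is taken relative to the set, so that on \<open>[0,T) \<times> V\<close> with \<open>V\<close> open
  it is one-sided in time at \<open>t = 0\<close>. On such sets (and on open sets) the relative derivative
  is unique, so \<open>smooth_on\<close> is \<open>C\<^sup>\<infinity>\<close> up to the time boundary.\<close>

primrec Ck_on ::
  "nat \<Rightarrow> 'a::real_normed_vector set \<Rightarrow> ('a \<Rightarrow> 'b::real_normed_vector) \<Rightarrow> bool" where
  "Ck_on 0 S f \<longleftrightarrow> continuous_on S f"
| "Ck_on (Suc k) S f \<longleftrightarrow>
     f differentiable_on S \<and> (\<forall>v. Ck_on k S (\<lambda>x. frechet_derivative f (at x within S) v))"

definition smooth_on ::
  "'a::real_normed_vector set \<Rightarrow> ('a \<Rightarrow> 'b::real_normed_vector) \<Rightarrow> bool" where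
  "smooth_on S f \<longleftrightarrow> (\<forall>k. Ck_on k S f)"


section \<open>Smooth manifolds (without boundary)\<close>

text \<open>A chart is a pair of its domain and its coordinate map; the values of the coordinate map
  outside the domain are irrelevant.\<close>

type_synonym ('m, 'n) chart = "'m set \<times> ('m \<Rightarrow> real ^ 'n)"

abbreviation chart_dom :: "('m, 'n::finite) chart \<Rightarrow> 'm set" where
  "chart_dom c \<equiv> fst c"

abbreviation chart_map :: "('m, 'n::finite) chart \<Rightarrow> 'm \<Rightarrow> real ^ 'n" where
  "chart_map c \<equiv> snd c"

definition chart_inv :: "('m, 'n::finite) chart \<Rightarrow> real ^ 'n \<Rightarrow> 'm" where
  "chart_inv c = inv_into (chart_dom c) (chart_map c)"

definition is_chart :: "'m topology \<Rightarrow> ('m, 'n::finite) chart \<Rightarrow> bool" where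
  "is_chart M c \<longleftrightarrow>
     openin M (chart_dom c) \<and> open (chart_map c ` chart_dom c) \<and>
     homeomorphic_map (subtopology M (chart_dom c))
       (top_of_set (chart_map c ` chart_dom c)) (chart_map c)"

definition transition ::
  "('m, 'n::finite) chart \<Rightarrow> ('m, 'n) chart \<Rightarrow> real ^ 'n \<Rightarrow> real ^ 'n" where
  "transition c d = chart_map d \<circ> chart_inv c"

definition smooth_atlas :: "'m topology \<Rightarrow> ('m, 'n::finite) chart set \<Rightarrow> bool" where
  "smooth_atlas M A \<longleftrightarrow>
     (\<forall>c\<in>A. is_chart M c) \<and> (\<Union>c\<in>A. chart_dom c) = topspace M \<and>
     (\<forall>c\<in>A. \<forall>d\<in>A. smooth_on (chart_map c ` (chart_dom c \<inter> chart_dom d)) (transition c d))"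

definition smooth_manifold :: "'m topology \<Rightarrow> ('m, 'n::finite) chart set \<Rightarrow> bool" where
  "smooth_manifold M A \<longleftrightarrow> Hausdorff_space M \<and> second_countable M \<and> smooth_atlas M A"

text \<open>That \<open>A \<union> B\<close> is a smooth atlas says that \<open>B\<close> belongs to the smooth structure of \<open>A\<close>.\<close>

definition orientable :: "'m topology \<Rightarrow> ('m, 'n::finite) chart set \<Rightarrow> bool" where
  "orientable M A \<longleftrightarrow>
     (\<exists>B. smooth_atlas M B \<and> smooth_atlas M (A \<union> B) \<and>
       (\<forall>c\<in>B. \<forall>d\<in>B. \<forall>y \<in> chart_map c ` (chart_dom c \<inter> chart_dom d).
          0 < det (matrix (frechet_derivative (transition c d) (at y)))))"


section \<open>Geometry of an immersed hypersurface\<close>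

text \<open>\<open>partial c i u x\<close> is \<open>\<partial>u/\<partial>x\<^sup>i\<close> at \<open>x\<close> in the coordinates of \<open>c\<close>.\<close>

definition partial ::
  "('m, 'n::finite) chart \<Rightarrow> 'n \<Rightarrow> ('m \<Rightarrow> 'b::real_normed_vector) \<Rightarrow> 'm \<Rightarrow> 'b" where
  "partial c i u x =
     frechet_derivative (\<lambda>y. u (chart_inv c y)) (at (chart_map c x)) (axis i 1)"

definition immersion ::
  "('m, 'n::finite) chart set \<Rightarrow> ('m \<Rightarrow> 'b::real_normed_vector) \<Rightarrow> bool" where
  "immersion A f \<longleftrightarrow>
     (\<forall>c\<in>A. \<forall>y \<in> chart_map c ` chart_dom c.
        inj (frechet_derivative (\<lambda>z. f (chart_inv c z)) (at y)))"

definition metric ::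
  "('m, 'n::finite) chart \<Rightarrow> ('m \<Rightarrow> 'b::real_inner) \<Rightarrow> 'm \<Rightarrow> real ^ 'n ^ 'n" where
  "metric c f x = (\<chi> i j. partial c i f x \<bullet> partial c j f x)"

abbreviation inverse_metric ::
  "('m, 'n::finite) chart \<Rightarrow> ('m \<Rightarrow> 'b::real_inner) \<Rightarrow> 'm \<Rightarrow> real ^ 'n ^ 'n" where
  "inverse_metric c f x \<equiv> matrix_inv (metric c f x)"

text \<open>On scalar functions and on the vector-valued map \<open>\<nu>\<close> (componentwise in the flat
  ambient space) the covariant derivative \<open>\<nabla>\<^sub>j\<close> is the partial derivative \<open>\<partial>\<^sub>j\<close>.\<close>

definition second_fundamental_form ::
  "('m, 'n::finite) chart \<Rightarrow> ('m \<Rightarrow> 'b::real_inner) \<Rightarrow> ('m \<Rightarrow> 'b) \<Rightarrow> 'm \<Rightarrow> real ^ 'n ^ 'n" where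
  "second_fundamental_form c f \<nu> x = (\<chi> i j. - (partial c i f x \<bullet> partial c j \<nu> x))"

text \<open>The quantities below are independent of the chart around \<open>x\<close> within a smooth atlas,
  so they may be evaluated in an arbitrarily chosen one.\<close>

definition chart_at :: "('m, 'n::finite) chart set \<Rightarrow> 'm \<Rightarrow> ('m, 'n) chart" where
  "chart_at A x = (SOME c. c \<in> A \<and> x \<in> chart_dom c)"

definition mean_curvature ::
  "('m, 'n::finite) chart set \<Rightarrow> ('m \<Rightarrow> 'b::real_inner) \<Rightarrow> ('m \<Rightarrow> 'b) \<Rightarrow> 'm \<Rightarrow> real" where
  "mean_curvature A f \<nu> x =
     (let c = chart_at A x in
      \<Sum>i\<in>UNIV. \<Sum>j\<in>UNIV. inverse_metric c f x $ i $ j * second_fundamental_form c f \<nu> x $ i $ j)"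

definition gradient ::
  "('m, 'n::finite) chart set \<Rightarrow> ('m \<Rightarrow> 'b::real_inner) \<Rightarrow> ('m \<Rightarrow> real) \<Rightarrow> 'm \<Rightarrow> 'b" where
  "gradient A f u x =
     (let c = chart_at A x in
      \<Sum>i\<in>UNIV. (\<Sum>j\<in>UNIV. inverse_metric c f x $ i $ j * partial c j u x) *\<^sub>R partial c i f x)"

definition tangential_part ::
  "('m, 'n::finite) chart set \<Rightarrow> ('m \<Rightarrow> 'b::real_inner) \<Rightarrow> 'm \<Rightarrow> 'b \<Rightarrow> 'b" where
  "tangential_part A f x v =
     (let c = chart_at A x in
      \<Sum>i\<in>UNIV. (\<Sum>j\<in>UNIV. inverse_metric c f x $ i $ j * (v \<bullet> partial c j f x)) *\<^sub>R partial c i f x)"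


section \<open>Families of immersions and the flow\<close>

definition time_dom :: "ereal \<Rightarrow> real set" where
  "time_dom T = {t. 0 \<le> t \<and> ereal t < T}"

definition smooth_family ::
  "('m, 'n::finite) chart set \<Rightarrow> ereal \<Rightarrow> (real \<Rightarrow> 'm \<Rightarrow> 'b::real_normed_vector) \<Rightarrow> bool" where
  "smooth_family A T u \<longleftrightarrow>
     (\<forall>c\<in>A. smooth_on (time_dom T \<times> chart_map c ` chart_dom c) (\<lambda>(t, y). u t (chart_inv c y)))"

definition time_deriv ::
  "ereal \<Rightarrow> (real \<Rightarrow> 'm \<Rightarrow> 'b::real_normed_vector) \<Rightarrow> real \<Rightarrow> 'm \<Rightarrow> 'b" where
  "time_deriv T u t x = vector_derivative (\<lambda>s. u s x) (at t within time_dom T)"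

definition smooth_immersion_family ::
  "('m, 'n::finite) chart set \<Rightarrow> ereal \<Rightarrow> (real \<Rightarrow> 'm \<Rightarrow> 'b::real_normed_vector) \<Rightarrow> bool" where
  "smooth_immersion_family A T F \<longleftrightarrow>
     smooth_family A T F \<and> (\<forall>t\<in>time_dom T. immersion A (F t))"

text \<open>In codimension one this determines \<open>\<nu>\<close> up to sign on each connected component of the
  manifold; no sign is singled out. In particular the inward pointing choice in the compact
  case is allowed.\<close>

definition unit_normal ::
  "('m, 'n::finite) chart set \<Rightarrow> ereal \<Rightarrow>
   (real \<Rightarrow> 'm \<Rightarrow> 'b::real_inner) \<Rightarrow> (real \<Rightarrow> 'm \<Rightarrow> 'b) \<Rightarrow> bool" where
  "unit_normal A T F \<nu> \<longleftrightarrow>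
     smooth_family A T \<nu> \<and>
     (\<forall>t\<in>time_dom T. \<forall>c\<in>A. \<forall>x\<in>chart_dom c.
        norm (\<nu> t x) = 1 \<and> (\<forall>i. \<nu> t x \<bullet> partial c i (F t) x = 0))"

definition normal_speed ::
  "ereal \<Rightarrow> (real \<Rightarrow> 'm \<Rightarrow> 'b::real_inner) \<Rightarrow> (real \<Rightarrow> 'm \<Rightarrow> 'b) \<Rightarrow> real \<Rightarrow> 'm \<Rightarrow> real" where
  "normal_speed T F \<nu> t x = time_deriv T F t x \<bullet> \<nu> t x"

definition energy_density ::
  "nat \<Rightarrow> ereal \<Rightarrow> (real \<Rightarrow> 'm \<Rightarrow> 'b::real_inner) \<Rightarrow> real \<Rightarrow> 'm \<Rightarrow> real" where
  "energy_density n T F t x = ((norm (time_deriv T F t x))\<^sup>2 + real n) / 2"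

definition normal_HMCF ::
  "'m topology \<Rightarrow> ('m, 'n::finite) chart set \<Rightarrow> ereal \<Rightarrow>
   (real \<Rightarrow> 'm \<Rightarrow> 'b::real_inner) \<Rightarrow> (real \<Rightarrow> 'm \<Rightarrow> 'b) \<Rightarrow> bool" where
  "normal_HMCF M A T F \<nu> \<longleftrightarrow>
     (let e = energy_density CARD('n) T F in
      (\<forall>t\<in>time_dom T. \<forall>x\<in>topspace M.
         time_deriv T (time_deriv T F) t x =
           (e t x * mean_curvature A (F t) (\<nu> t) x) *\<^sub>R \<nu> t x - gradient A (F t) (e t) x) \<and>
      (\<forall>x\<in>topspace M. tangential_part A (F 0) x (time_deriv T F 0 x) = 0))"

end

theory Submission
  imports Defs
begin

text \<open>The flow preserves the vanishing of the tangential velocity: \<open>\<partial>\<^sub>t\<langle>F\<^sub>t, F\<^sub>i\<rangle>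
  = - \<partial>\<^sub>i e + \<langle>F\<^sub>t, \<partial>\<^sub>i F\<^sub>t\<rangle> = 0\<close>. Hence \<open>F\<^sub>t = \<sigma> \<nu>\<close> and \<open>e = (\<sigma>\<^sup>2 + n) / 2\<close>, so that
  \<open>\<sigma>\<^sub>t = \<langle>F\<^sub>t\<^sub>t, \<nu>\<rangle> + \<sigma> \<langle>\<nu>, \<nu>\<^sub>t\<rangle> = e H\<close>, which says that \<open>\<gamma>\<close> is a primitive of \<open>H\<close>. It is
  bounded because \<open>arctan\<close> is, and the mean value theorem for \<open>\<gamma>\<close> on long intervals yields
  times at which \<open>H\<close> is small.\<close>

section \<open>Calculus on products of a time set and an open set\<close>

lemma has_vector_derivative_first_slice:
  assumes "(G has_derivative G') (at (t, z) within I \<times> V)" "z \<in> V"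
  shows "((\<lambda>s. G (s, z)) has_vector_derivative G' (1, 0)) (at t within I)"
proof -
  interpret bounded_linear G' using assms(1) by (rule has_derivative_bounded_linear)
  have "((\<lambda>s. (s, z)) has_derivative (\<lambda>r. (r, 0))) (at t within I)"
    by (auto intro!: derivative_eq_intros)
  then have "((\<lambda>s. G (s, z)) has_derivative (\<lambda>r. G' (r, 0))) (at t within I)"
    by (rule has_derivative_in_compose[where g = G and g' = G'])
      (rule has_derivative_subset[OF assms(1)], use assms(2) in auto)
  moreover have "(\<lambda>r. G' (r, 0)) = (\<lambda>r. r *\<^sub>R G' (1, 0))"
    by (simp flip: scaleR)
  ultimately show ?thesis by (simp only: has_vector_derivative_def)
qed

lemma has_derivative_second_slice:
  assumes "(G has_derivative G') (at (t, z) within I \<times> V)" "t \<in> I"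
  shows "((\<lambda>z. G (t, z)) has_derivative (\<lambda>v. G' (0, v))) (at z within V)"
proof -
  have "((\<lambda>z. (t, z)) has_derivative (\<lambda>v. (0, v))) (at z within V)"
    by (auto intro!: derivative_eq_intros)
  then show ?thesis
    by (rule has_derivative_in_compose[where g = G and g' = G'])
      (rule has_derivative_subset[OF assms(1)], use assms(2) in auto)
qed

text \<open>Differentiating \<open>G(s, z) - G(a, z) = \<integral> \<partial>\<^sub>tG\<close> in \<open>z\<close> under the integral sign, rather than
  using the symmetry of second derivatives at interior points, covers the endpoint \<open>t = a\<close>.\<close>

lemma has_vector_derivative_mixed_partial:
  fixes G :: "real \<times> 'a::real_normed_vector \<Rightarrow> 'b::banach" and v :: 'a and I V
  defines "D \<equiv> \<lambda>w p. frechet_derivative G (at p within I \<times> V) w"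
  assumes G: "Ck_on 2 (I \<times> V) G" and "open V" "z \<in> V" "{a..b} \<subseteq> I" and t: "t \<in> {a..b}"
  shows "((\<lambda>s. D (0, v) (s, z)) has_vector_derivative
            frechet_derivative (D (1, 0)) (at (t, z) within I \<times> V) (0, v)) (at t within {a..b})"
proof -
  let ?S = "I \<times> V"
  define R where "R p = frechet_derivative (D (1, 0)) (at p within ?S) (0, v)" for p
  have diffG: "G differentiable_on ?S" and diffD: "\<And>w. D w differentiable_on ?S"
    and contR: "continuous_on ?S R"
    using G by (auto simp: numeral_2_eq_2 D_def R_def)
  have derG: "(G has_derivative (\<lambda>w. D w p)) (at p within ?S)" if "p \<in> ?S" for p
    using diffG that by (auto simp: D_def differentiable_on_def frechet_derivative_works)
  have derD: "(D (1, 0) has_derivative frechet_derivative (D (1, 0)) (at p within ?S)) (at p within ?S)"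
    if "p \<in> ?S" for p
    using diffD that by (auto simp: differentiable_on_def frechet_derivative_works)
  obtain d where d: "d > 0" "\<And>r. \<bar>r\<bar> < d \<Longrightarrow> z + r *\<^sub>R v \<in> V"
  proof -
    have "open ((\<lambda>r::real. z + r *\<^sub>R v) -` V)"
      using \<open>open V\<close> by (intro open_vimage continuous_intros)
    moreover have "0 \<in> (\<lambda>r::real. z + r *\<^sub>R v) -` V"
      using \<open>z \<in> V\<close> by simp
    ultimately obtain d where "d > 0" "ball 0 d \<subseteq> (\<lambda>r::real. z + r *\<^sub>R v) -` V"
      using open_contains_ball by blast
    then show ?thesis
      using that by (auto simp: subset_iff)
  qed
  \<comment> \<open>An open interval around 0 on which the line \<open>z + r *\<^sub>R v\<close>
    stays in \<open>V\<close>. Derivatives in direction \<open>v\<close> become derivatives in the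
    real parameter \<open>r\<close>, and since \<open>U\<close> is open those at 0 are
    unique.\<close>
  define U where "U = {-d<..<d}"
  have U: "z + r *\<^sub>R v \<in> V" if "r \<in> U" for r
    using d(2)[of r] that by (auto simp: U_def)
  have line: "((\<lambda>r. f (z + r *\<^sub>R v)) has_vector_derivative f' v) (at r within U)"
    if "(f has_derivative f') (at (z + r *\<^sub>R v) within V)" "r \<in> U" for f f' and r :: real
  proof -
    interpret bounded_linear f' using that(1) by (rule has_derivative_bounded_linear)
    have "((\<lambda>r. z + r *\<^sub>R v) has_derivative (\<lambda>r. r *\<^sub>R v)) (at r within U)"
      by (auto intro!: derivative_eq_intros)
    then have "((\<lambda>r. f (z + r *\<^sub>R v)) has_derivative (\<lambda>r. f' (r *\<^sub>R v))) (at r within U)"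
      by (rule has_derivative_in_compose[where g = f and g' = f'])
        (rule has_derivative_subset[OF that(1)], use U in auto)
    then show ?thesis
      by (simp add: has_vector_derivative_def scaleR)
  qed
  \<comment> \<open>The derivative at \<open>r = 0\<close> of G(s, z + r v) - G(a, z + r v) is
    computed twice: under the integral sign in \<open>1\<close>, and directly in \<open>2\<close>.
    Equating the results gives the claim.\<close>
  have D0v: "D (0, v) (s, z) = D (0, v) (a, z) + integral {a..s} (\<lambda>\<tau>. R (\<tau>, z))"
    if s: "s \<in> {a..b}" for s
  proof -
    have sub: "{a..s} \<subseteq> I" and I: "a \<in> I" "s \<in> I" using s assms(5) by auto
    have ftc: "((\<lambda>\<tau>. D (1, 0) (\<tau>, z')) has_integral G (s, z') - G (a, z')) {a..s}"
      if "z' \<in> V" for z'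
    proof (rule fundamental_theorem_of_calculus)
      show "((\<lambda>\<tau>. G (\<tau>, z')) has_vector_derivative D (1, 0) (\<tau>, z')) (at \<tau> within {a..s})"
        if "\<tau> \<in> {a..s}" for \<tau>
        using has_vector_derivative_first_slice[OF derG] that \<open>z' \<in> V\<close> sub
        by (blast intro: has_vector_derivative_within_subset)
    qed (use s in auto)
    have 1: "((\<lambda>r. integral (cbox a s) (\<lambda>\<tau>. D (1, 0) (\<tau>, z + r *\<^sub>R v))) has_vector_derivative
        integral (cbox a s) (\<lambda>\<tau>. R (\<tau>, z + 0 *\<^sub>R v))) (at 0 within U)"
    proof (rule leibniz_rule_vector_derivative)
      fix r \<tau> assume *: "r \<in> U" "\<tau> \<in> cbox a s"
      then have "(\<tau>, z + r *\<^sub>R v) \<in> ?S" using U sub by auto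
      from has_derivative_second_slice[OF derD[OF this]] *
      show "((\<lambda>r. D (1, 0) (\<tau>, z + r *\<^sub>R v)) has_vector_derivative R (\<tau>, z + r *\<^sub>R v)) (at r within U)"
        unfolding R_def using sub by (intro line) auto
    next
      fix r assume "r \<in> U"
      then show "(\<lambda>\<tau>. D (1, 0) (\<tau>, z + r *\<^sub>R v)) integrable_on cbox a s"
        using ftc[OF U] by (auto simp: has_integral_integrable)
    next
      \<comment> \<open>This is where second-order regularity enters: the mixed derivative must be
        jointly continuous in the parameter and in time.\<close>
      show "continuous_on (U \<times> cbox a s) (\<lambda>(r, \<tau>). R (\<tau>, z + r *\<^sub>R v))"
        unfolding split_beta
        by (rule continuous_on_compose2[OF contR]) (use U sub in \<open>auto intro!: continuous_intros\<close>)
    qed (use d in \<open>auto simp: U_def\<close>)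
    have 2: "((\<lambda>r. G (s, z + r *\<^sub>R v) - G (a, z + r *\<^sub>R v)) has_vector_derivative
        D (0, v) (s, z) - D (0, v) (a, z)) (at 0 within U)"
    proof (intro derivative_intros)
      have *: "((\<lambda>r. G (\<tau>, z + r *\<^sub>R v)) has_vector_derivative D (0, v) (\<tau>, z)) (at 0 within U)"
        if "\<tau> \<in> I" for \<tau>
        using line[of "\<lambda>z. G (\<tau>, z)" "\<lambda>v. D (0, v) (\<tau>, z)" 0]
          has_derivative_second_slice[OF derG, of \<tau> z] that \<open>z \<in> V\<close> d(1)
        by (auto simp: U_def)
      show "((\<lambda>r. G (s, z + r *\<^sub>R v)) has_vector_derivative D (0, v) (s, z)) (at 0 within U)"
        "((\<lambda>r. G (a, z + r *\<^sub>R v)) has_vector_derivative D (0, v) (a, z)) (at 0 within U)"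
        using * I by auto
    qed
    have 3: "((\<lambda>r. integral (cbox a s) (\<lambda>\<tau>. D (1, 0) (\<tau>, z + r *\<^sub>R v))) has_vector_derivative
        D (0, v) (s, z) - D (0, v) (a, z)) (at 0 within U)"
      by (rule has_vector_derivative_transform[OF _ _ 2])
        (use ftc U d(1) in \<open>auto simp: U_def intro!: integral_unique\<close>)
    have "at 0 within U = at (0::real)"
      using d(1) by (intro at_within_open) (auto simp: U_def)
    with 1 3 show ?thesis
      using vector_derivative_unique_at by (fastforce simp: algebra_simps)
  qed
  \<comment> \<open>By \<open>D0v\<close> the spatial derivative is a constant plus an integral with
    continuous integrand, so its one-sided or two-sided time derivative is that integrand.\<close>
  have "continuous_on {a..b} (\<lambda>\<tau>. R (\<tau>, z))"
    by (rule continuous_on_compose2[OF contR]) (use assms in \<open>auto intro!: continuous_intros\<close>)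
  then have "((\<lambda>s. D (0, v) (a, z) + integral {a..s} (\<lambda>\<tau>. R (\<tau>, z))) has_vector_derivative
      0 + R (t, z)) (at t within {a..b})"
    by (intro derivative_intros integral_has_vector_derivative t)
  then have "((\<lambda>s. D (0, v) (s, z)) has_vector_derivative R (t, z)) (at t within {a..b})"
    by (intro has_vector_derivative_transform[OF t D0v]) auto
  then show ?thesis by (simp add: R_def)
qed

section \<open>Linear algebra of Gram matrices and hyperplane normals\<close>

text \<open>If g v = 0, then L v is orthogonal to every L e_i. Expanding one factor of L v \<bullet>
  L v in these vectors gives L v = 0, and injectivity gives v = 0.\<close>

lemma invertible_gram:
  fixes L :: "real ^ 'n \<Rightarrow> 'b::real_inner"
  assumes "linear L" "inj L"
  shows "invertible (\<chi> i j. L (axis i 1) \<bullet> L (axis j 1))"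
proof -
  let ?g = "\<chi> i j. L (axis i 1) \<bullet> L (axis j 1)"
  have L: "L v = (\<Sum>j\<in>UNIV. v $ j *\<^sub>R L (axis j 1))" for v
  proof -
    have "L v = L (\<Sum>j\<in>UNIV. v $ j *\<^sub>R axis j 1)"
      by (simp add: basis_expansion scalar_mult_eq_scaleR[symmetric])
    then show ?thesis
      by (simp add: linear_sum[OF assms(1)] linear_scale[OF assms(1)])
  qed
  have "v = 0" if "?g *v v = 0" for v
  proof -
    have *: "L (axis i 1) \<bullet> L v = 0" for i
    proof -
      have "L (axis i 1) \<bullet> L v = (?g *v v) $ i"
        by (subst L[of v]) (simp add: matrix_vector_mult_def inner_sum_right mult.commute)
      then show ?thesis using that by simp
    qed
    have "L v \<bullet> L v = (\<Sum>j\<in>UNIV. v $ j * (L (axis j 1) \<bullet> L v))"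
      by (subst (1) L) (simp add: inner_sum_left)
    then have "L v = 0" by (simp add: *)
    then show ?thesis
      using assms linear_injective_0 by blast
  qed
  then have "inj ((*v) ?g)"
    by (simp add: linear_injective_0[OF matrix_vector_mul_linear])
  then show ?thesis
    by (simp add: invertible_left_inverse matrix_left_invertible_injective)
qed

text \<open>Raising the index of b and pairing with a tangent vector lowers it again: this is g
  g^{-1} b = b. With b the partial derivatives of a function, or the inner products of a vector with
  the tangent vectors, it handles both the gradient and the tangential part.\<close>

lemma inverse_gram_inner:
  fixes L :: "real ^ 'n \<Rightarrow> 'b::real_inner"
  assumes "linear L" "inj L"
  defines "g \<equiv> \<chi> i j. L (axis i 1) \<bullet> L (axis j 1)"
  shows "(\<Sum>i\<in>UNIV. (\<Sum>j\<in>UNIV. matrix_inv g $ i $ j * b j) *\<^sub>R L (axis i 1)) \<bullet> L (axis k 1) = b k"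
proof -
  \<comment> \<open>\<open>matrix_inv\<close> is a choice; invertibility makes the chosen matrix a
    genuine inverse.\<close>
  have "g ** matrix_inv g = mat 1"
    using invertible_gram[OF assms(1,2)] unfolding g_def matrix_inv_def invertible_def
    by (rule someI2_ex) auto
  then have "g *v (matrix_inv g *v (\<chi> j. b j)) = (\<chi> j. b j)"
    by (metis matrix_vector_mul_assoc matrix_vector_mul_lid)
  moreover have "g $ k $ i = L (axis i 1) \<bullet> L (axis k 1)" for i
    by (simp add: g_def inner_commute)
  then have "(g *v (matrix_inv g *v (\<chi> j. b j))) $ k =
      (\<Sum>i\<in>UNIV. (\<Sum>j\<in>UNIV. matrix_inv g $ i $ j * b j) *\<^sub>R L (axis i 1)) \<bullet> L (axis k 1)"
    by (simp add: matrix_vector_mult_def inner_sum_left mult.commute)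
  ultimately show ?thesis by simp
qed

text \<open>In codimension one the orthogonal complement of the range of L is a line. If the part u
  of w orthogonal to \<nu> were nonzero, u and \<nu> would be two independent vectors on that
  line.\<close>

lemma normal_to_hyperplane_unique:
  fixes L :: "real ^ 'n \<Rightarrow> 'b::euclidean_space"
  assumes L: "linear L" "inj L" and dim: "DIM('b) = CARD('n) + 1"
    and \<nu>: "norm \<nu> = 1" "\<And>i. \<nu> \<bullet> L (axis i 1) = 0" and w: "\<And>i. w \<bullet> L (axis i 1) = 0"
  shows "w = (w \<bullet> \<nu>) *\<^sub>R \<nu>"
proof -
  let ?C = "{y \<in> UNIV. \<forall>x \<in> range L. orthogonal x y}"
  have "dim ?C + dim (range L) = dim (UNIV :: 'b set)"
    by (intro dim_subspace_orthogonal_to_vectors) (auto simp: L linear_subspace_image)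
  moreover have "dim (range L) = CARD('n)"
    using dim_image_eq[OF L(1), of UNIV] L(2) by simp
  ultimately have C: "dim ?C = 1" using dim by simp
  have perp: "u \<in> ?C" if u: "\<And>i. u \<bullet> L (axis i 1) = 0" for u
  proof -
    have "L v \<bullet> u = 0" for v
    proof -
      have "L v = L (\<Sum>j\<in>UNIV. v $ j *\<^sub>R axis j 1)"
        by (simp add: basis_expansion scalar_mult_eq_scaleR[symmetric])
      then show ?thesis
        using u by (simp add: linear_sum[OF L(1)] linear_scale[OF L(1)] inner_sum_right inner_commute)
    qed
    then show ?thesis by (auto simp: orthogonal_def)
  qed
  define u where "u = w - (w \<bullet> \<nu>) *\<^sub>R \<nu>"
  have "\<nu> \<bullet> \<nu> = 1" using \<nu>(1) by (simp add: norm_eq_1)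
  then have orth: "u \<bullet> \<nu> = 0" by (simp add: u_def inner_diff_left)
  have "u = 0"
  proof (rule ccontr)
    assume "u \<noteq> 0"
    have "pairwise orthogonal {u, \<nu>}"
      using orth by (auto simp: pairwise_def orthogonal_def inner_commute)
    then have "independent {u, \<nu>}"
      using \<open>u \<noteq> 0\<close> \<nu>(1) by (intro pairwise_orthogonal_independent) auto
    moreover have "{u, \<nu>} \<subseteq> ?C"
      using perp[of u] perp[of \<nu>] \<nu>(2) w by (auto simp: u_def inner_diff_left)
    ultimately have "card {u, \<nu>} \<le> dim ?C"
      using independent_card_le_dim by blast
    moreover have "u \<noteq> \<nu>" using orth \<open>\<nu> \<bullet> \<nu> = 1\<close> by auto
    ultimately show False using C by simp
  qed
  then show ?thesis by (simp add: u_def)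
qed


section \<open>Locality of derivatives, charts and the time interval\<close>

text \<open>\<open>frechet_derivative\<close> chooses among all derivatives relative to S. Functions
  agreeing on S have the same candidates, hence the same choice, even where the derivative is not
  unique.\<close>

lemma frechet_derivative_within_cong:
  assumes "\<And>p. p \<in> S \<Longrightarrow> f p = g p" "p \<in> S"
  shows "frechet_derivative f (at p within S) = frechet_derivative g (at p within S)"
proof -
  have "(f has_derivative f') (at p within S) \<longleftrightarrow> (g has_derivative f') (at p within S)" for f'
    using assms by (metis has_derivative_transform)
  then show ?thesis by (simp add: frechet_derivative_def)
qed

lemma Ck_on_cong:
  assumes "\<And>p. p \<in> S \<Longrightarrow> f p = g p"
  shows "Ck_on k S f \<longleftrightarrow> Ck_on k S g"
  using assms
proof (induction k arbitrary: f g)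
  case 0
  then show ?case by (auto intro: continuous_on_cong)
next
  case (Suc k)
  have "f differentiable_on S \<longleftrightarrow> g differentiable_on S"
    using Suc.prems unfolding differentiable_on_def differentiable_def
    by (metis has_derivative_transform)
  moreover have "Ck_on k S (\<lambda>p. frechet_derivative f (at p within S) v) \<longleftrightarrow>
      Ck_on k S (\<lambda>p. frechet_derivative g (at p within S) v)" for v
    using Suc.prems by (intro Suc.IH) (simp cong: frechet_derivative_within_cong)
  ultimately show ?case by simp
qed

lemma chart_inv_chart_map:
  assumes "is_chart M c" "x \<in> chart_dom c"
  shows "chart_inv c (chart_map c x) = x"
proof -
  have "chart_dom c \<subseteq> topspace M"
    using assms(1) by (auto simp: is_chart_def openin_subset)
  then have "inj_on (chart_map c) (chart_dom c)"
    using assms(1) homeomorphic_imp_injective_map[of "subtopology M (chart_dom c)"]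
    by (fastforce simp: is_chart_def topspace_subtopology Int_absorb1)
  then show ?thesis
    using assms(2) by (simp add: chart_inv_def)
qed

text \<open>A nondegenerate interval has no isolated points. This makes time derivatives relative to
  \<open>time_dom T\<close> unique, including the one-sided one at time 0.\<close>

lemma time_dom_at_within_nontrivial:
  assumes "0 < T" "t \<in> time_dom T"
  shows "at t within time_dom T \<noteq> bot"
proof -
  obtain b where b: "ereal 0 < ereal b" "ereal b < T"
    using ereal_dense2[OF assms(1)] by (metis ereal_eq_0(2))
  have "is_interval (time_dom T)"
    unfolding is_interval_1 time_dom_def by (auto intro: le_less_trans[where y = "ereal _"])
  moreover have "0 \<in> time_dom T" "b \<in> time_dom T" "b \<noteq> 0"
    using b assms(1) by (auto simp: time_dom_def zero_ereal_def)
  ultimately have "t islimpt time_dom T"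
    using assms(2) by (intro connected_imp_perfect) (auto simp: is_interval_connected)
  then show ?thesis by (simp add: trivial_limit_within)
qed

lemma atLeastAtMost_subset_time_dom:
  assumes "0 \<le> a" "b \<in> time_dom T"
  shows "{a..b} \<subseteq> time_dom T"
  using assms by (auto simp: time_dom_def intro: le_less_trans[where y = "ereal b"])

section \<open>Smooth families in charts\<close>

lemma smooth_family_has_derivative:
  fixes u :: "real \<Rightarrow> 'm \<Rightarrow> 'b::real_normed_vector"
  assumes "smooth_family A T u" "c \<in> A" "t \<in> time_dom T" "z \<in> chart_map c ` chart_dom c"
  defines "S \<equiv> time_dom T \<times> chart_map c ` chart_dom c"
  shows "((\<lambda>(t, z). u t (chart_inv c z)) has_derivative
    frechet_derivative (\<lambda>(t, z). u t (chart_inv c z)) (at (t, z) within S)) (at (t, z) within S)"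
proof -
  have "Ck_on (Suc 0) S (\<lambda>(t, z). u t (chart_inv c z))"
    using assms by (auto simp: smooth_family_def smooth_on_def simp del: Ck_on.simps)
  then have "(\<lambda>(t, z). u t (chart_inv c z)) differentiable_on S"
    by simp
  then have "(\<lambda>(t, z). u t (chart_inv c z)) differentiable (at (t, z) within S)"
    using assms by (auto simp: differentiable_on_def)
  then show ?thesis
    using frechet_derivative_works by blast
qed

text \<open>The second claim links \<open>time_deriv\<close>, defined pointwise on the manifold, to
  the derivative in direction (1, 0) on the chart product, where smoothness is formulated.\<close>

lemma smooth_family_has_vector_derivative:
  fixes u :: "real \<Rightarrow> 'm \<Rightarrow> 'b::real_normed_vector"
  assumes "smooth_family A T u" "0 < T" "c \<in> A" "t \<in> time_dom T" "z \<in> chart_map c ` chart_dom c"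
  shows "((\<lambda>s. u s (chart_inv c z)) has_vector_derivative time_deriv T u t (chart_inv c z))
      (at t within time_dom T)"
    and "time_deriv T u t (chart_inv c z) = frechet_derivative (\<lambda>(t, z). u t (chart_inv c z))
      (at (t, z) within time_dom T \<times> chart_map c ` chart_dom c) (1, 0)"
proof -
  note * = has_vector_derivative_first_slice[OF smooth_family_has_derivative[OF assms(1,3-5)] assms(5),
      simplified]
  show eq: "time_deriv T u t (chart_inv c z) = frechet_derivative (\<lambda>(t, z). u t (chart_inv c z))
      (at (t, z) within time_dom T \<times> chart_map c ` chart_dom c) (1, 0)"
    unfolding time_deriv_def
    by (rule vector_derivative_within[OF time_dom_at_within_nontrivial[OF assms(2,4)] *])
  show "((\<lambda>s. u s (chart_inv c z)) has_vector_derivative time_deriv T u t (chart_inv c z))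
      (at t within time_dom T)"
    unfolding eq by (rule *)
qed

text \<open>In a chart the time derivative is a directional derivative, and a directional derivative
  of a C^{k+1} map is C^k by the recursion defining \<open>Ck_on\<close>.\<close>

lemma smooth_family_time_deriv:
  fixes u :: "real \<Rightarrow> 'm \<Rightarrow> 'b::real_normed_vector"
  assumes "smooth_family A T u" "0 < T"
  shows "smooth_family A T (time_deriv T u)"
  unfolding smooth_family_def smooth_on_def
proof (intro ballI allI)
  fix c k assume "c \<in> A"
  let ?S = "time_dom T \<times> chart_map c ` chart_dom c"
  have "Ck_on (Suc k) ?S (\<lambda>(t, z). u t (chart_inv c z))"
    using assms \<open>c \<in> A\<close> by (auto simp: smooth_family_def smooth_on_def simp del: Ck_on.simps)
  then have *: "Ck_on k ?S (\<lambda>p. frechet_derivative (\<lambda>(t, z). u t (chart_inv c z)) (at p within ?S) (1, 0))"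
    by simp
  have "(case p of (t, z) \<Rightarrow> time_deriv T u t (chart_inv c z)) =
      frechet_derivative (\<lambda>(t, z). u t (chart_inv c z)) (at p within ?S) (1, 0)" if "p \<in> ?S" for p
    using that smooth_family_has_vector_derivative(2)[OF assms \<open>c \<in> A\<close>] by (cases p) simp
  from Ck_on_cong[OF this] * show "Ck_on k ?S (\<lambda>(t, z). time_deriv T u t (chart_inv c z))"
    by (rule iffD2)
qed

text \<open>The chart image is open, so the derivative relative to it is the unrestricted one used
  by \<open>partial\<close>; restricting the product derivative to a time slice identifies the
  two.\<close>

lemma smooth_family_spatial_derivative:
  fixes u :: "real \<Rightarrow> 'm \<Rightarrow> 'b::real_normed_vector"
  assumes "smooth_family A T u" "c \<in> A" "is_chart M c" "t \<in> time_dom T" "x \<in> chart_dom c"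
  shows "((\<lambda>z. u t (chart_inv c z)) has_derivative
        frechet_derivative (\<lambda>z. u t (chart_inv c z)) (at (chart_map c x))) (at (chart_map c x))"
    and "partial c i (u t) x = frechet_derivative (\<lambda>(t, z). u t (chart_inv c z))
      (at (t, chart_map c x) within time_dom T \<times> chart_map c ` chart_dom c) (0, axis i 1)"
proof -
  let ?V = "chart_map c ` chart_dom c"
  have z: "chart_map c x \<in> ?V" using assms by simp
  have "at (chart_map c x) within ?V = at (chart_map c x)"
    using assms(3) z by (intro at_within_open) (auto simp: is_chart_def)
  then have *: "((\<lambda>z. u t (chart_inv c z)) has_derivative
      (\<lambda>v. frechet_derivative (\<lambda>(t, z). u t (chart_inv c z))
        (at (t, chart_map c x) within time_dom T \<times> ?V) (0, v))) (at (chart_map c x))"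
    using has_derivative_second_slice[OF smooth_family_has_derivative[OF assms(1,2,4) z] assms(4)]
    by simp
  show "((\<lambda>z. u t (chart_inv c z)) has_derivative
        frechet_derivative (\<lambda>z. u t (chart_inv c z)) (at (chart_map c x))) (at (chart_map c x))"
    using * frechet_derivative_at by metis
  show "partial c i (u t) x = frechet_derivative (\<lambda>(t, z). u t (chart_inv c z))
      (at (t, chart_map c x) within time_dom T \<times> ?V) (0, axis i 1)"
    unfolding partial_def frechet_derivative_at[OF *, symmetric] ..
qed

text \<open>Time and coordinate derivatives commute, also at the ends of the interval: this is
  \<open>has_vector_derivative_mixed_partial\<close> read in a chart.\<close>

lemma has_vector_derivative_partial:
  fixes u :: "real \<Rightarrow> 'm \<Rightarrow> 'b::banach"
  assumes u: "smooth_family A T u" and "0 < T" "c \<in> A" "is_chart M c" "x \<in> chart_dom c"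
    and ab: "{a..b} \<subseteq> time_dom T" and t: "t \<in> {a..b}"
  shows "((\<lambda>s. partial c i (u s) x) has_vector_derivative partial c i (time_deriv T u t) x)
    (at t within {a..b})"
proof -
  let ?V = "chart_map c ` chart_dom c"
  let ?S = "time_dom T \<times> ?V"
  let ?G = "\<lambda>(t, z). u t (chart_inv c z)"
  have z: "chart_map c x \<in> ?V" using assms by simp
  have "partial c i (time_deriv T u t) x = frechet_derivative
      (\<lambda>(t, z). time_deriv T u t (chart_inv c z)) (at (t, chart_map c x) within ?S) (0, axis i 1)"
    using smooth_family_spatial_derivative(2)[OF smooth_family_time_deriv[OF u \<open>0 < T\<close>]] assms by blast
  \<comment> \<open>The two inner functions are known to agree only on the chart product, which
    suffices for derivatives relative to it.\<close>
  also have "\<dots> = frechet_derivative (\<lambda>p. frechet_derivative ?G (at p within ?S) (1, 0))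
      (at (t, chart_map c x) within ?S) (0, axis i 1)"
    using smooth_family_has_vector_derivative(2)[OF u \<open>0 < T\<close> \<open>c \<in> A\<close>] z ab t
    by (subst frechet_derivative_within_cong) auto
  finally have eq: "partial c i (time_deriv T u t) x = \<dots>" .
  have "((\<lambda>s. frechet_derivative ?G (at (s, chart_map c x) within ?S) (0, axis i 1))
      has_vector_derivative partial c i (time_deriv T u t) x) (at t within {a..b})"
    unfolding eq
  proof (rule has_vector_derivative_mixed_partial)
    show "Ck_on 2 ?S ?G"
      using u \<open>c \<in> A\<close> by (auto simp: smooth_family_def smooth_on_def)
  qed (use assms z in \<open>auto simp: is_chart_def\<close>)
  then show ?thesis
    by (rule has_vector_derivative_transform[rotated 2])
      (use smooth_family_spatial_derivative(2)[OF u \<open>c \<in> A\<close> \<open>is_chart M c\<close>] assms in auto)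
qed

text \<open>Differentiating (w \<bullet> w + n) / 2 for the velocity w leaves w \<bullet>
  \<partial>_i w, the term that cancels when the tangential velocity is differentiated in
  time.\<close>

lemma partial_energy_density:
  fixes F :: "real \<Rightarrow> 'm \<Rightarrow> 'b::real_inner"
  assumes "smooth_family A T F" "0 < T" "c \<in> A" "is_chart M c" "t \<in> time_dom T" "x \<in> chart_dom c"
  shows "partial c i (energy_density n T F t) x =
    time_deriv T F t x \<bullet> partial c i (time_deriv T F t) x"
proof -
  let ?w = "\<lambda>z. time_deriv T F t (chart_inv c z)"
  let ?y = "chart_map c x"
  have "(?w has_derivative frechet_derivative ?w (at ?y)) (at ?y)"
    by (rule smooth_family_spatial_derivative(1)[OF smooth_family_time_deriv[OF assms(1,2)] assms(3-6)])
  then have "((\<lambda>z. (?w z \<bullet> ?w z + real n) / 2) has_derivative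
      (\<lambda>v. ?w ?y \<bullet> frechet_derivative ?w (at ?y) v)) (at ?y)"
    by (auto intro!: derivative_eq_intros simp: inner_commute)
  from frechet_derivative_at[OF this, symmetric] show ?thesis
    by (simp add: partial_def energy_density_def power2_norm_eq_inner
        chart_inv_chart_map[OF assms(4,6)])
qed

section \<open>Gradient and tangential part in the chosen chart\<close>

text \<open>Both vectors are built by raising an index with the inverse metric, so
  \<open>inverse_gram_inner\<close> applies to both. The chart is \<open>chart_at A x\<close>
  because the invariant quantities are evaluated there.\<close>

lemma gradient_inner_partial:
  assumes "((\<lambda>z. f (chart_inv c z)) has_derivative L) (at (chart_map c x))" "inj L"
    and c: "c = chart_at A x"
  shows "gradient A f u x \<bullet> partial c k f x = partial c k u x"
    and "tangential_part A f x v \<bullet> partial c k f x = v \<bullet> partial c k f x"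
proof -
  have partial: "partial c i f x = L (axis i 1)" for i
    unfolding partial_def frechet_derivative_at[OF assms(1), symmetric] ..
  have "linear L"
    using assms(1) has_derivative_linear by blast
  note * = inverse_gram_inner[OF this assms(2)]
  show "gradient A f u x \<bullet> partial c k f x = partial c k u x"
    by (simp add: gradient_def metric_def partial * flip: c)
  show "tangential_part A f x v \<bullet> partial c k f x = v \<bullet> partial c k f x"
    by (simp add: tangential_part_def metric_def partial * flip: c)
qed

lemma gradient_inner_normal:
  assumes "\<And>i. \<nu> \<bullet> partial (chart_at A x) i f x = 0"
  shows "gradient A f u x \<bullet> \<nu> = 0"
  using assms by (simp add: gradient_def Let_def inner_sum_right inner_commute[of _ \<nu>])

lemma chart_at:
  assumes "smooth_atlas M A" "x \<in> topspace M"
  shows "chart_at A x \<in> A" "x \<in> chart_dom (chart_at A x)" "is_chart M (chart_at A x)"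
proof -
  have "x \<in> (\<Union>c\<in>A. chart_dom c)"
    using assms by (simp add: smooth_atlas_def)
  then have "\<exists>c. c \<in> A \<and> x \<in> chart_dom c"
    by blast
  from someI_ex[OF this] show "chart_at A x \<in> A" "x \<in> chart_dom (chart_at A x)"
    by (auto simp: chart_at_def)
  then show "is_chart M (chart_at A x)"
    using assms(1) by (auto simp: smooth_atlas_def)
qed

section \<open>Consequences of the flow equation\<close>

locale normal_HMCF_solution =
  fixes M :: "'m topology"
    and A :: "('m, 'n::finite) chart set"
    and T :: ereal
    and F \<nu> :: "real \<Rightarrow> 'm \<Rightarrow> 'b::euclidean_space"
  assumes atlas: "smooth_atlas M A"
    and codim: "DIM('b) = CARD('n) + 1"
    and T_pos: "0 < T"
    and immersions: "smooth_immersion_family A T F"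
    and normal: "unit_normal A T F \<nu>"
    and flow: "normal_HMCF M A T F \<nu>"
begin

abbreviation H :: "real \<Rightarrow> 'm \<Rightarrow> real" where
  "H t x \<equiv> mean_curvature A (F t) (\<nu> t) x"

abbreviation \<sigma> :: "real \<Rightarrow> 'm \<Rightarrow> real" where
  "\<sigma> \<equiv> normal_speed T F \<nu>"

lemma smooth: "smooth_family A T F" "smooth_family A T (time_deriv T F)" "smooth_family A T \<nu>"
  using immersions normal smooth_family_time_deriv T_pos
  by (auto simp: smooth_immersion_family_def unit_normal_def)

lemma flow_eq:
  assumes "x \<in> topspace M" "t \<in> time_dom T"
  shows "time_deriv T (time_deriv T F) t x =
    (energy_density CARD('n) T F t x * H t x) *\<^sub>R \<nu> t x - gradient A (F t) (energy_density CARD('n) T F t) x"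
  using flow assms by (simp add: normal_HMCF_def Let_def)

lemma has_vector_derivative_time:
  assumes "smooth_family A T u" "x \<in> topspace M" "t \<in> time_dom T"
  shows "((\<lambda>s. u s x) has_vector_derivative time_deriv T u t x) (at t within time_dom T)"
proof -
  note c = chart_at[OF atlas assms(2)]
  show ?thesis
    using smooth_family_has_vector_derivative(1)[OF assms(1) T_pos c(1) assms(3),
        of "chart_map (chart_at A x) x"] c(2)
    by (simp add: chart_inv_chart_map[OF c(3,2)])
qed

lemma normal_props:
  assumes "x \<in> topspace M" "t \<in> time_dom T"
  shows "norm (\<nu> t x) = 1" "\<nu> t x \<bullet> partial (chart_at A x) i (F t) x = 0"
  using normal chart_at[OF atlas assms(1)] assms(2) by (auto simp: unit_normal_def)

lemma immersion_derivative:
  assumes "x \<in> topspace M" "t \<in> time_dom T"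
  defines "L \<equiv> frechet_derivative (\<lambda>z. F t (chart_inv (chart_at A x) z))
    (at (chart_map (chart_at A x) x))"
  shows "((\<lambda>z. F t (chart_inv (chart_at A x) z)) has_derivative L) (at (chart_map (chart_at A x) x))"
    and "inj L"
proof -
  note c = chart_at[OF atlas assms(1)]
  show "((\<lambda>z. F t (chart_inv (chart_at A x) z)) has_derivative L) (at (chart_map (chart_at A x) x))"
    unfolding L_def by (rule smooth_family_spatial_derivative(1)[OF smooth(1) c(1,3) assms(2) c(2)])
  show "inj L"
    using immersions c assms(2) by (auto simp: L_def smooth_immersion_family_def immersion_def)
qed

lemma velocity_orthogonal:
  assumes x: "x \<in> topspace M" and t: "t \<in> time_dom T"
  shows "time_deriv T F t x \<bullet> partial (chart_at A x) i (F t) x = 0"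
proof -
  let ?c = "chart_at A x"
  let ?w = "\<lambda>s. time_deriv T F s x \<bullet> partial ?c i (F s) x"
  note c = chart_at[OF atlas x]
  have sub: "{0..t} \<subseteq> time_dom T"
    using atLeastAtMost_subset_time_dom t by blast
  have const: "(?w has_vector_derivative 0) (at s within {0..t})" if s: "s \<in> {0..t}" for s
  proof -
    have s': "s \<in> time_dom T" using s sub by auto
    have Ft: "((\<lambda>s. time_deriv T F s x) has_vector_derivative time_deriv T (time_deriv T F) s x)
        (at s within {0..t})"
      using has_vector_derivative_within_subset[OF has_vector_derivative_time[OF smooth(2) x s'] sub] .
    have Fi: "((\<lambda>s. partial ?c i (F s) x) has_vector_derivative partial ?c i (time_deriv T F s) x)
        (at s within {0..t})"
      by (rule has_vector_derivative_partial[OF smooth(1) T_pos c(1,3,2) sub s])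
    \<comment> \<open>Paired with F_i, the normal term of the flow equation vanishes and the
      gradient term gives the partial derivative of e.\<close>
    have "time_deriv T (time_deriv T F) s x \<bullet> partial ?c i (F s) x = - partial ?c i (energy_density CARD('n) T F s) x"
      using normal_props(2)[OF x s'] gradient_inner_partial(1)[OF immersion_derivative[OF x s'] refl]
      by (simp add: flow_eq[OF x s'] inner_diff_left)
    also have "\<dots> = - (time_deriv T F s x \<bullet> partial ?c i (time_deriv T F s) x)"
      by (simp add: partial_energy_density[OF smooth(1) T_pos c(1,3) s' c(2)])
    finally have "time_deriv T F s x \<bullet> partial ?c i (time_deriv T F s) x
        + time_deriv T (time_deriv T F) s x \<bullet> partial ?c i (F s) x = 0"
      by simp
    with bounded_bilinear.has_vector_derivative[OF bounded_bilinear_inner Ft Fi]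
    show ?thesis by simp
  qed
  obtain k where k: "\<And>s. s \<in> {0..t} \<Longrightarrow> ?w s = k"
    using has_vector_derivative_zero_constant[OF convex_real_interval(5) const] by blast
  have t0: "0 \<le> t" "0 \<in> time_dom T"
    using t T_pos by (auto simp: time_dom_def zero_ereal_def)
  \<comment> \<open>The initial condition fixes the constant: pairing the tangential part with F_i
    returns the inner product of velocity and F_i at time 0.\<close>
  have "tangential_part A (F 0) x (time_deriv T F 0 x) = 0"
    using flow x by (simp add: normal_HMCF_def Let_def)
  then have "?w 0 = 0"
    using gradient_inner_partial(2)[OF immersion_derivative[OF x t0(2)] refl,
        of "time_deriv T F 0 x" i] by simp
  with k[of 0] k[of t] t0 show ?thesis by simp
qed

lemma velocity_normal:
  assumes "x \<in> topspace M" "t \<in> time_dom T"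
  shows "time_deriv T F t x = \<sigma> t x *\<^sub>R \<nu> t x"
proof -
  note L = immersion_derivative[OF assms]
  show ?thesis
    unfolding normal_speed_def
    by (rule normal_to_hyperplane_unique[OF has_derivative_linear[OF L(1)] L(2) codim])
      (use normal_props[OF assms] velocity_orthogonal[OF assms] in \<open>auto simp: partial_def\<close>)
qed

lemma normal_speed_derivative:
  assumes x: "x \<in> topspace M" and t: "t \<in> time_dom T"
  shows "((\<lambda>s. \<sigma> s x) has_real_derivative ((\<sigma> t x)\<^sup>2 + CARD('n)) / 2 * H t x)
    (at t within time_dom T)"
proof -
  note \<nu>' = has_vector_derivative_time[OF smooth(3) x t]
  have unit: "\<nu> s x \<bullet> \<nu> s x = 1" if "s \<in> time_dom T" for s
    using normal_props(1)[OF x that] by (simp add: norm_eq_1)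
  \<comment> \<open>Differentiating \<nu> \<bullet> \<nu> = 1 shows that \<nu>_t is orthogonal to
    \<nu>, hence to the velocity \<sigma> \<nu>. So the term with \<nu>_t drops out of the
    derivative of \<sigma>.\<close>
  have "((\<lambda>s. 1) has_vector_derivative
      \<nu> t x \<bullet> time_deriv T \<nu> t x + time_deriv T \<nu> t x \<bullet> \<nu> t x) (at t within time_dom T)"
    by (rule has_vector_derivative_transform[OF t _
          bounded_bilinear.has_vector_derivative[OF bounded_bilinear_inner \<nu>' \<nu>']])
      (simp add: unit)
  then have "\<nu> t x \<bullet> time_deriv T \<nu> t x + time_deriv T \<nu> t x \<bullet> \<nu> t x = 0"
    using vector_derivative_unique_within[OF time_dom_at_within_nontrivial[OF T_pos t]]
      has_vector_derivative_const by blast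
  then have rotation: "time_deriv T F t x \<bullet> time_deriv T \<nu> t x = 0"
    by (simp add: velocity_normal[OF x t] inner_commute)
  have tangential: "gradient A (F t) (energy_density CARD('n) T F t) x \<bullet> \<nu> t x = 0"
    by (rule gradient_inner_normal) (rule normal_props(2)[OF x t])
  have energy: "((\<sigma> t x)\<^sup>2 + CARD('n)) / 2 = energy_density CARD('n) T F t x"
    using normal_props(1)[OF x t] by (simp add: energy_density_def velocity_normal[OF x t])
  show ?thesis
    unfolding energy
    using bounded_bilinear.has_vector_derivative[OF bounded_bilinear_inner
        has_vector_derivative_time[OF smooth(2) x t] \<nu>']
    by (simp add: rotation tangential normal_speed_def has_real_derivative_iff_has_vector_derivative
        flow_eq[OF x t] inner_diff_left unit[OF t])
qed

section \<open>The bounded primitive of the mean curvature\<close>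

definition \<gamma> :: "real \<Rightarrow> 'm \<Rightarrow> real" where
  "\<gamma> t x = 2 / sqrt (CARD('n)) * arctan (\<sigma> t x / sqrt (CARD('n)))"

text \<open>With r = sqrt n, the outer derivative contributes (2/r) (1/r) / (1 + \<sigma>^2/r^2) = 2
  / (\<sigma>^2 + r^2). This is exactly 1/e, and it cancels the factor e in \<sigma>_t = e
  H.\<close>

lemma \<gamma>_derivative:
  assumes x: "x \<in> topspace M" and t: "t \<in> time_dom T"
  shows "((\<lambda>s. \<gamma> s x) has_real_derivative H t x) (at t within time_dom T)"
proof -
  define r where "r = sqrt (CARD('n))"
  have r: "r > 0" "real CARD('n) = r\<^sup>2" by (simp_all add: r_def)
  have pos: "(\<sigma> t x)\<^sup>2 + r\<^sup>2 > 0"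
    using r(1) by (intro add_nonneg_pos) auto
  have "((\<lambda>s. 2 / r * arctan (\<sigma> s x / r)) has_real_derivative
      2 / r * (1 / (1 + (\<sigma> t x / r)\<^sup>2) * (((\<sigma> t x)\<^sup>2 + r\<^sup>2) / 2 * H t x / r)))
      (at t within time_dom T)"
    using DERIV_cmult[OF DERIV_chain2[OF DERIV_arctan DERIV_cdivide[OF
          normal_speed_derivative[OF x t], of r]], of "2 / r"]
    by (simp only: r(2) inverse_eq_divide)
  also have "1 + (\<sigma> t x / r)\<^sup>2 = ((\<sigma> t x)\<^sup>2 + r\<^sup>2) / r\<^sup>2"
    using r(1) by (simp add: power_divide add_divide_distrib)
  also have "2 / r * (1 / (((\<sigma> t x)\<^sup>2 + r\<^sup>2) / r\<^sup>2) * (((\<sigma> t x)\<^sup>2 + r\<^sup>2) / 2 * H t x / r)) = H t x"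
    using r(1) pos by (simp add: power2_eq_square)
  finally show ?thesis
    by (simp add: \<gamma>_def r_def)
qed

text \<open>Values of \<open>arctan\<close> lie in (-pi/2, pi/2), so two of them differ by at most
  pi; the prefactor scales this bound.\<close>

lemma \<gamma>_diff_bound: "\<bar>\<gamma> s x - \<gamma> t x\<bar> \<le> 2 * pi / sqrt (CARD('n))"
proof -
  let ?a = "\<lambda>t. arctan (\<sigma> t x / sqrt (CARD('n)))"
  have "\<bar>?a s - ?a t\<bar> \<le> pi"
    using arctan_bounded[of "\<sigma> s x / sqrt (CARD('n))"] arctan_bounded[of "\<sigma> t x / sqrt (CARD('n))"]
    by linarith
  then have "2 / sqrt (CARD('n)) * \<bar>?a s - ?a t\<bar> \<le> 2 / sqrt (CARD('n)) * pi"
    by (intro mult_left_mono) auto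
  moreover have "\<bar>\<gamma> s x - \<gamma> t x\<bar> = \<bar>2 / sqrt (CARD('n)) * (?a s - ?a t)\<bar>"
    by (simp only: \<gamma>_def right_diff_distrib)
  then have "\<bar>\<gamma> s x - \<gamma> t x\<bar> = 2 / sqrt (CARD('n)) * \<bar>?a s - ?a t\<bar>"
    by (simp only: abs_mult) simp
  ultimately show ?thesis
    by simp
qed

lemma has_integral_mean_curvature:
  assumes "x \<in> topspace M" "0 \<le> t1" "t1 \<le> t2" "ereal t2 < T"
  shows "((\<lambda>t. H t x) has_integral \<gamma> t2 x - \<gamma> t1 x) {t1..t2}"
proof (rule fundamental_theorem_of_calculus)
  have "{t1..t2} \<subseteq> time_dom T"
    using assms by (intro atLeastAtMost_subset_time_dom) (auto simp: time_dom_def)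
  then show "((\<lambda>t. \<gamma> t x) has_vector_derivative H t x) (at t within {t1..t2})"
    if "t \<in> {t1..t2}" for t
    using DERIV_subset[OF \<gamma>_derivative[OF assms(1)]] that
    by (metis has_real_derivative_iff_has_vector_derivative subsetD)
qed (fact assms)

lemma mean_curvature_small:
  assumes T: "T = \<infinity>" and x: "x \<in> topspace M" and "\<epsilon> > 0" "a \<ge> 0"
  obtains t where "t > a" "\<bar>H t x\<bar> < \<epsilon>"
proof -
  let ?C = "2 * pi / sqrt (CARD('n))"
  \<comment> \<open>The interval length is chosen so that \<epsilon> d = C + \<epsilon> exceeds the
    bound C on the oscillation of \<gamma>. By the mean value theorem some t satisfies |H| d \<le> C
    < \<epsilon> d.\<close>
  define d where "d = ?C / \<epsilon> + 1"
  have "?C / \<epsilon> \<ge> 0" using \<open>\<epsilon> > 0\<close> by simp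
  then have d: "d > 0" by (simp add: d_def)
  have "{a..a + d} \<subseteq> time_dom T"
    using \<open>a \<ge> 0\<close> by (auto simp: T time_dom_def)
  then have "((\<lambda>t. \<gamma> t x) has_derivative (\<lambda>h. H t x * h)) (at t within {a..a + d})"
    if "a \<le> t" "t \<le> a + d" for t
    using DERIV_subset[OF \<gamma>_derivative[OF x], of t "{a..a + d}"] that
    by (simp add: has_field_derivative_def subset_iff)
  from mvt_simple[OF _ this] d obtain t where t: "t \<in> {a<..<a + d}" "\<gamma> (a + d) x - \<gamma> a x = H t x * d"
    by auto
  have "\<bar>H t x\<bar> * d \<le> ?C"
    using \<gamma>_diff_bound[of "a + d" x a] d by (simp add: t(2) abs_mult)
  also have "?C < \<epsilon> * d"
    using \<open>\<epsilon> > 0\<close> by (simp add: d_def distrib_left)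
  finally show ?thesis
    using that[of t] t(1) d by simp
qed

end

theorem proposition7p2:
  fixes M :: "'m topology"
    and A :: "('m, 'n::finite) chart set"
    and T :: ereal
    and F \<nu> :: "real \<Rightarrow> 'm \<Rightarrow> real ^ 'N"
  assumes "smooth_manifold M A" and "orientable M A"
    and "CARD('N) = CARD('n) + 1"
    and "0 < T"
    and "smooth_immersion_family A T F"
    and "unit_normal A T F \<nu>"
    and "normal_HMCF M A T F \<nu>"
  shows
    "let n = real CARD('n);
         H = (\<lambda>x t. mean_curvature A (F t) (\<nu> t) x);
         \<gamma> = (\<lambda>x t. 2 / sqrt n * arctan (normal_speed T F \<nu> t x / sqrt n))
     in (\<forall>x\<in>topspace M. \<forall>t1 t2. 0 \<le> t1 \<and> t1 \<le> t2 \<and> ereal t2 < T \<longrightarrow>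
           H x integrable_on {t1..t2} \<and>
           \<bar>integral {t1..t2} (H x)\<bar> = \<bar>\<gamma> x t2 - \<gamma> x t1\<bar> \<and>
           \<bar>\<gamma> x t2 - \<gamma> x t1\<bar> \<le> 2 * pi / sqrt n) \<and>
        (T = \<infinity> \<longrightarrow>
           (\<forall>\<epsilon>>0. \<forall>x\<in>topspace M.
              \<exists>s::nat \<Rightarrow> real. (\<forall>k. 0 \<le> s k) \<and> filterlim s at_top sequentially \<and>
                (\<forall>k. \<bar>H x (s k)\<bar> < \<epsilon>)))"
proof -
  interpret normal_HMCF_solution M A T F \<nu>
    using assms by unfold_locales (auto simp: smooth_manifold_def)
  have "(\<lambda>t. H t x) integrable_on {t1..t2} \<and>
      \<bar>integral {t1..t2} (\<lambda>t. H t x)\<bar> = \<bar>\<gamma> t2 x - \<gamma> t1 x\<bar> \<and>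
      \<bar>\<gamma> t2 x - \<gamma> t1 x\<bar> \<le> 2 * pi / sqrt (CARD('n))"
    if "x \<in> topspace M" "0 \<le> t1" "t1 \<le> t2" "ereal t2 < T" for x t1 t2
    using has_integral_mean_curvature[OF that] \<gamma>_diff_bound
    by (auto simp: integrable_on_def integral_unique)
  moreover have "\<exists>s::nat \<Rightarrow> real. (\<forall>k. 0 \<le> s k) \<and> filterlim s at_top sequentially \<and>
      (\<forall>k. \<bar>H (s k) x\<bar> < \<epsilon>)"
    if "T = \<infinity>" "\<epsilon> > 0" "x \<in> topspace M" for \<epsilon> x
  proof -
    \<comment> \<open>Taking the k-th time beyond k forces the sequence to infinity and keeps it
      nonnegative.\<close>
    have "\<forall>k::nat. \<exists>t. t > real k \<and> \<bar>H t x\<bar> < \<epsilon>"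
      using mean_curvature_small[OF that(1,3,2)] by (metis of_nat_0_le_iff)
    then obtain s where s: "\<And>k::nat. s k > real k" "\<And>k. \<bar>H (s k) x\<bar> < \<epsilon>"
      by metis
    have "filterlim s at_top sequentially"
      by (rule filterlim_at_top_mono[OF filterlim_real_sequentially])
        (use s(1) in \<open>auto intro: always_eventually less_imp_le\<close>)
    moreover have "0 \<le> s k" for k
      using s(1)[of k] of_nat_0_le_iff[of k] by linarith
    ultimately show ?thesis
      using s(2) by blast
  qed
  ultimately show ?thesis
    unfolding Let_def \<gamma>_def by blast
qed

end
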